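(* Let $H=\mathbb R^2$, let $Q\colon\mathbb R^2\to\mathbb R^2$ be the counter-clockwise rotation by $90^\circ$ (a monotone and Lipschitz continuous operator), let $\alpha=3$ and $t_0>0$. For each of the two edge values $\theta=1$ and $\theta=\alpha-1=2$, there exists a solution $x\colon[t_0,+\infty)\to\mathbb R^2$ of $$\ddot x(t)+\frac{\alpha}{t}\dot x(t)+\frac{d}{dt}Q(x(t))+\frac{\theta}{t}Q(x(t))=0,\qquad t\ge t_0,$$ and constants $c>0$, $t_1>t_0$ such that $t\,\|Q(x(t))\|\ge c$ for all $t\ge t_1$. In particular, the rate $\|Q(x(t))\|=o(t^{-1})$ as $t\to+\infty$ cannot be achieved in general when $\theta\in\{1,\alpha-1\}$.
   Context: This concerns the dynamical system $\ddot x(t)+\frac{\alpha}{t}\dot x(t)+\beta(t)\frac{d}{dt}Q(x(t))+b(t)Q(x(t))=0$ with $b(t)=(1-\eta)\dot\beta(t)+\theta\frac{\beta(t)}{t}$, $\theta=(1-\eta)+\eta(\alpha-1)$, in the case $\beta\equiv1$ and the edge parameters $\eta=0$ (i.e. $\theta=1$) and $\eta=1$ (i.e. $\theta=\alpha-1$). *)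

theory Defs
  imports "HOL-Analysis.Analysis" "HOL-Library.Landau_Symbols"
begin

definition rotation90 :: "real^2 \<Rightarrow> real^2" where
  "rotation90 p = vector [- (p $ 2), p $ 1]"

definition monotone_operator :: "('a::real_inner \<Rightarrow> 'a) \<Rightarrow> bool" where
  "monotone_operator Q \<longleftrightarrow> (\<forall>x y. 0 \<le> (x - y) \<bullet> (Q x - Q y))"

definition lipschitz_operator :: "('a::metric_space \<Rightarrow> 'a) \<Rightarrow> bool" where
  "lipschitz_operator Q \<longleftrightarrow> (\<exists>L. L-lipschitz_on UNIV Q)"

(* Classical (twice continuously differentiable) solutions on the closed half-line, with
   one-sided derivatives at t0. The derivative q of Q \<circ> x is required to exist.
   Values of x to the left of t0 are irrelevant. *)
definition solves_ode_on ::
    "real \<Rightarrow> real \<Rightarrow> ('a::real_normed_vector \<Rightarrow> 'a) \<Rightarrow> real \<Rightarrow> (real \<Rightarrow> 'a) \<Rightarrow> bool" where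
  "solves_ode_on \<alpha> \<theta> Q t0 x \<longleftrightarrow>
    (\<exists>x' x'' q. continuous_on {t0..} x'' \<and>
      (\<forall>t\<in>{t0..}.
        (x has_vector_derivative x' t) (at t within {t0..}) \<and>
        (x' has_vector_derivative x'' t) (at t within {t0..}) \<and>
        ((\<lambda>s. Q (x s)) has_vector_derivative q t) (at t within {t0..}) \<and>
        x'' t + (\<alpha> / t) *\<^sub>R x' t + q t + (\<theta> / t) *\<^sub>R Q (x t) = 0))"

end

theory Submission
  imports Defs
begin

text \<open>Identify the plane with the complex numbers, so that \<^term>\<open>rotation90\<close> is multiplication
  by \<open>i\<close>. After multiplication by \<open>t\<close> the system becomes
  \<open>t z'' + (3 + i t) z' + i \<theta> z = 0\<close>,
  and the substitution \<open>s = - i t\<close> turns it into Kummer's confluent hypergeometric equation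
  \<open>s w'' + (3 - s) w' - \<theta> w = 0\<close>. At both edge values it has an elementary solution that decays
  only like \<open>1 / s\<close>:
  \<^item> for \<open>\<theta> = 1\<close>, the function \<open>w = s\<^sup>-\<^sup>2 + s\<^sup>-\<^sup>1\<close>, which gives, up to a constant
    factor, \<open>z = 1 / t + i / t\<^sup>2\<close>;
  \<^item> for \<open>\<theta> = 2\<close>, Kummer's transformation \<open>w(s) = e\<^sup>s v(- s)\<close> exchanges \<open>\<theta>\<close> and \<open>3 - \<theta>\<close>, so
    the previous solution yields, again up to a constant factor, \<open>z = e\<^sup>-\<^sup>i\<^sup>t (1 / t - i / t\<^sup>2)\<close>.

  In both cases \<open>\<bar>z\<bar>\<^sup>2 = 1 / t\<^sup>2 + 1 / t\<^sup>4\<close>, hence \<open>t \<bar>z\<bar> \<ge> 1\<close>. Since the rotation is an isometry,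
  the lower bound passes to \<open>Q(x(t))\<close>, and such a bound excludes the rate \<open>o(1 / t)\<close>
  (lemma \<open>not_smallo_inverse_if_lower_bound\<close>).\<close>

section \<open>The rotation operator\<close>

lemma norm_vector_2: "norm (vector [u, v] :: real^2) = sqrt (u\<^sup>2 + v\<^sup>2)"
  by (simp add: norm_vec_def L2_set_def sum_2)

lemma rotation90_vector: "rotation90 (vector [u, v]) = vector [- v, u]"
  by (simp add: rotation90_def)

lemma norm_rotation90: "norm (rotation90 p) = norm p"
  by (simp add: rotation90_def norm_vec_def L2_set_def sum_2 add.commute)

lemma rotation90_diff: "rotation90 p - rotation90 q = rotation90 (p - q)"
  by (simp add: rotation90_def vec_eq_iff forall_2)

text \<open>Monotonicity holds with equality: a vector is orthogonal to its rotation.\<close>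
lemma monotone_rotation90: "monotone_operator rotation90"
  unfolding monotone_operator_def rotation90_diff
  by (simp add: rotation90_def inner_vec_def sum_2 algebra_simps)

lemma lipschitz_rotation90: "lipschitz_operator rotation90"
  unfolding lipschitz_operator_def lipschitz_on_def dist_norm rotation90_diff norm_rotation90
  by (intro exI[of _ 1]) simp

section \<open>Reduction to coordinates\<close>

lemma vector_2_eq_axes:
  "(vector [a, b] :: real^2) = a *\<^sub>R axis 1 1 + b *\<^sub>R axis 2 1"
  by (simp add: vec_eq_iff forall_2 axis_def)

lemma has_vector_derivative_vector_2:
  assumes "(u has_real_derivative u') (at t within S)"
    and "(v has_real_derivative v') (at t within S)"
  shows "((\<lambda>s. vector [u s, v s] :: real^2) has_vector_derivative vector [u', v']) (at t within S)"
  unfolding vector_2_eq_axes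
  using assms by (auto intro!: derivative_eq_intros)

lemma continuous_on_vector_2:
  assumes "continuous_on S u" and "continuous_on S v"
  shows "continuous_on S (\<lambda>s. vector [u s, v s] :: real^2)"
  unfolding vector_2_eq_axes using assms by (intro continuous_intros)

lemma solves_ode_on_rotation90I:
  assumes du: "\<And>t. t \<ge> t0 \<Longrightarrow> (u has_real_derivative u' t) (at t)"
    and dv: "\<And>t. t \<ge> t0 \<Longrightarrow> (v has_real_derivative v' t) (at t)"
    and ddu: "\<And>t. t \<ge> t0 \<Longrightarrow> (u' has_real_derivative u'' t) (at t)"
    and ddv: "\<And>t. t \<ge> t0 \<Longrightarrow> (v' has_real_derivative v'' t) (at t)"
    and cont: "continuous_on {t0..} u''" "continuous_on {t0..} v''"
    and eq_u: "\<And>t. t \<ge> t0 \<Longrightarrow> u'' t + \<alpha> / t * u' t - v' t - \<theta> / t * v t = 0"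
    and eq_v: "\<And>t. t \<ge> t0 \<Longrightarrow> v'' t + \<alpha> / t * v' t + u' t + \<theta> / t * u t = 0"
  shows "solves_ode_on \<alpha> \<theta> rotation90 t0 (\<lambda>t. vector [u t, v t])"
  unfolding solves_ode_on_def
proof (intro exI conjI ballI)
  show "continuous_on {t0..} (\<lambda>t. vector [u'' t, v'' t] :: real^2)"
    by (intro continuous_on_vector_2 cont)
next
  fix t assume "t \<in> {t0..}"
  then have t: "t \<ge> t0" by simp
  note D = du[OF t, THEN has_field_derivative_at_within] dv[OF t, THEN has_field_derivative_at_within]
    ddu[OF t, THEN has_field_derivative_at_within] ddv[OF t, THEN has_field_derivative_at_within]
  show "((\<lambda>t. vector [u t, v t] :: real^2)
      has_vector_derivative vector [u' t, v' t]) (at t within {t0..})"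
    by (intro has_vector_derivative_vector_2 D)
  show "((\<lambda>t. vector [u' t, v' t] :: real^2)
      has_vector_derivative vector [u'' t, v'' t]) (at t within {t0..})"
    by (intro has_vector_derivative_vector_2 D)
  show "((\<lambda>s. rotation90 (vector [u s, v s]))
      has_vector_derivative vector [- v' t, u' t]) (at t within {t0..})"
    unfolding rotation90_vector by (intro has_vector_derivative_vector_2 DERIV_minus D)
  show "vector [u'' t, v'' t] + (\<alpha> / t) *\<^sub>R vector [u' t, v' t] + vector [- v' t, u' t]
      + (\<theta> / t) *\<^sub>R rotation90 (vector [u t, v t]) = 0"
    unfolding rotation90_vector
    using eq_u[OF t] eq_v[OF t] by (simp add: vec_eq_iff forall_2)
qed

section \<open>Elementary solutions at the two edge values\<close>

lemma solution_theta_1: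
  assumes "t0 > 0"
  shows "solves_ode_on 3 1 rotation90 t0 (\<lambda>t. vector [1 / t, 1 / t^2])"
proof (rule solves_ode_on_rotation90I[where u' = "\<lambda>t. - 1 / t^2" and v' = "\<lambda>t. - 2 / t^3"
      and u'' = "\<lambda>t. 2 / t^3" and v'' = "\<lambda>t. 6 / t^4"])
  \<comment> \<open>Every function involved is a polynomial in \<open>inverse t\<close>; with all divisions written this
    way, only ring identities remain.\<close>
  fix t assume "t \<ge> t0"
  then have "t \<noteq> 0" using assms by simp
  show "((\<lambda>t. 1 / t) has_real_derivative - 1 / t^2) (at t)"
    unfolding divide_inverse power_inverse[symmetric]
    by (rule derivative_eq_intros refl \<open>t \<noteq> 0\<close> | simp add: algebra_simps eval_nat_numeral)+
  show "((\<lambda>t. 1 / t^2) has_real_derivative - 2 / t^3) (at t)"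
    unfolding divide_inverse power_inverse[symmetric]
    by (rule derivative_eq_intros refl \<open>t \<noteq> 0\<close> | simp add: algebra_simps eval_nat_numeral)+
  show "((\<lambda>t. - 1 / t^2) has_real_derivative 2 / t^3) (at t)"
    unfolding divide_inverse power_inverse[symmetric]
    by (rule derivative_eq_intros refl \<open>t \<noteq> 0\<close> | simp add: algebra_simps eval_nat_numeral)+
  show "((\<lambda>t. - 2 / t^3) has_real_derivative 6 / t^4) (at t)"
    unfolding divide_inverse power_inverse[symmetric]
    by (rule derivative_eq_intros refl \<open>t \<noteq> 0\<close> | simp add: algebra_simps eval_nat_numeral)+
  show "2 / t^3 + 3 / t * (- 1 / t^2) - (- 2 / t^3) - 1 / t * (1 / t^2) = 0"
    unfolding divide_inverse power_inverse[symmetric]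
    by (simp add: algebra_simps eval_nat_numeral)
  show "6 / t^4 + 3 / t * (- 2 / t^3) + (- 1 / t^2) + 1 / t * (1 / t) = 0"
    unfolding divide_inverse power_inverse[symmetric]
    by (simp add: algebra_simps eval_nat_numeral)
qed (use assms in \<open>auto intro!: continuous_intros\<close>)

text \<open>The coordinates are the real and imaginary parts of \<open>e\<^sup>-\<^sup>i\<^sup>t (1 / t - i / t\<^sup>2)\<close>. The first
  and second derivatives are
  \<open>e\<^sup>-\<^sup>i\<^sup>t (- i / t - 2 / t\<^sup>2 + 2 i / t\<^sup>3)\<close> and
  \<open>e\<^sup>-\<^sup>i\<^sup>t (- 1 / t + 3 i / t\<^sup>2 + 6 / t\<^sup>3 - 6 i / t\<^sup>4)\<close>.\<close>
lemma solution_theta_2: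
  assumes "t0 > 0"
  shows "solves_ode_on 3 2 rotation90 t0
    (\<lambda>t. vector [cos t / t - sin t / t^2, - sin t / t - cos t / t^2])"
proof (rule solves_ode_on_rotation90I[where
      u' = "\<lambda>t. - sin t / t - 2 * cos t / t^2 + 2 * sin t / t^3" and
      v' = "\<lambda>t. - cos t / t + 2 * sin t / t^2 + 2 * cos t / t^3" and
      u'' = "\<lambda>t. - cos t / t + 3 * sin t / t^2 + 6 * cos t / t^3 - 6 * sin t / t^4" and
      v'' = "\<lambda>t. sin t / t + 3 * cos t / t^2 - 6 * sin t / t^3 - 6 * cos t / t^4"])
  fix t assume "t \<ge> t0"
  then have "t \<noteq> 0" using assms by simp
  show "((\<lambda>t. cos t / t - sin t / t^2)
      has_real_derivative - sin t / t - 2 * cos t / t^2 + 2 * sin t / t^3) (at t)"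
    unfolding divide_inverse power_inverse[symmetric]
    by (rule derivative_eq_intros refl \<open>t \<noteq> 0\<close> | simp add: algebra_simps eval_nat_numeral)+
  show "((\<lambda>t. - sin t / t - cos t / t^2)
      has_real_derivative - cos t / t + 2 * sin t / t^2 + 2 * cos t / t^3) (at t)"
    unfolding divide_inverse power_inverse[symmetric]
    by (rule derivative_eq_intros refl \<open>t \<noteq> 0\<close> | simp add: algebra_simps eval_nat_numeral)+
  show "((\<lambda>t. - sin t / t - 2 * cos t / t^2 + 2 * sin t / t^3)
      has_real_derivative - cos t / t + 3 * sin t / t^2 + 6 * cos t / t^3 - 6 * sin t / t^4) (at t)"
    unfolding divide_inverse power_inverse[symmetric]
    by (rule derivative_eq_intros refl \<open>t \<noteq> 0\<close> | simp add: algebra_simps eval_nat_numeral)+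
  show "((\<lambda>t. - cos t / t + 2 * sin t / t^2 + 2 * cos t / t^3)
      has_real_derivative sin t / t + 3 * cos t / t^2 - 6 * sin t / t^3 - 6 * cos t / t^4) (at t)"
    unfolding divide_inverse power_inverse[symmetric]
    by (rule derivative_eq_intros refl \<open>t \<noteq> 0\<close> | simp add: algebra_simps eval_nat_numeral)+
  show "- cos t / t + 3 * sin t / t^2 + 6 * cos t / t^3 - 6 * sin t / t^4
      + 3 / t * (- sin t / t - 2 * cos t / t^2 + 2 * sin t / t^3)
      - (- cos t / t + 2 * sin t / t^2 + 2 * cos t / t^3) - 2 / t * (- sin t / t - cos t / t^2) = 0"
    unfolding divide_inverse power_inverse[symmetric]
    by (simp add: algebra_simps eval_nat_numeral)
  show "sin t / t + 3 * cos t / t^2 - 6 * sin t / t^3 - 6 * cos t / t^4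
      + 3 / t * (- cos t / t + 2 * sin t / t^2 + 2 * cos t / t^3)
      + (- sin t / t - 2 * cos t / t^2 + 2 * sin t / t^3) + 2 / t * (cos t / t - sin t / t^2) = 0"
    unfolding divide_inverse power_inverse[symmetric]
    by (simp add: algebra_simps eval_nat_numeral)
qed (use assms in \<open>auto intro!: continuous_intros\<close>)

section \<open>The lower bound and the failure of the fast rate\<close>

lemma norm_solution_theta_1:
  fixes t :: real
  shows "(norm (vector [1 / t, 1 / t^2] :: real^2))\<^sup>2 = 1 / t^2 + 1 / t^4"
  by (simp add: norm_vector_2 power_divide flip: power_mult)

lemma norm_solution_theta_2:
  fixes t :: real
  shows "(norm (vector [cos t / t - sin t / t^2, - sin t / t - cos t / t^2] :: real^2))\<^sup>2
    = 1 / t^2 + 1 / t^4"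
proof -
  have "(cos t / t - sin t / t^2)\<^sup>2 + (- sin t / t - cos t / t^2)\<^sup>2
      = ((sin t)\<^sup>2 + (cos t)\<^sup>2) * (1 / t^2 + 1 / t^4)"
    unfolding divide_inverse power_inverse[symmetric] by algebra
  then show ?thesis by (simp add: norm_vector_2)
qed

lemma mult_norm_ge_1:
  fixes z :: "'a::real_normed_vector"
  assumes "t > 0" and "(norm z)\<^sup>2 = 1 / t^2 + 1 / t^4"
  shows "t * norm z \<ge> 1"
proof -
  have "(1 / t)\<^sup>2 \<le> (norm z)\<^sup>2"
    using assms by (simp add: power_divide)
  then have "1 / t \<le> norm z"
    using power2_le_imp_le norm_ge_zero by blast
  then show ?thesis using assms(1) by (simp add: field_simps)
qed

lemma not_smallo_inverse_if_lower_bound: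
  fixes f :: "real \<Rightarrow> real"
  assumes "c > 0" and "\<And>t. t \<ge> t1 \<Longrightarrow> t * f t \<ge> c"
  shows "f \<notin> o[at_top](\<lambda>t. 1 / t)"
proof
  assume "f \<in> o[at_top](\<lambda>t. 1 / t)"
  then have "\<forall>\<^sub>F t in at_top. norm (f t) \<le> c / 2 * norm (1 / t)"
    by (rule landau_o.smallD) (use assms(1) in simp)
  moreover have "\<forall>\<^sub>F t in at_top. t \<ge> max 1 t1" by (rule eventually_ge_at_top)
  ultimately have "\<forall>\<^sub>F t::real in at_top. False"
  proof eventually_elim
    case (elim t)
    then have "t * f t \<le> c / 2"
      by (simp add: field_simps abs_le_iff)
    moreover have "t * f t \<ge> c" using assms(2) elim by simp
    ultimately show False using assms(1) by simp
  qed
  then show False by simp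
qed

theorem mainTheorem5:
  fixes \<alpha> t0 :: real and Q :: "real^2 \<Rightarrow> real^2"
  assumes "Q = rotation90" and "\<alpha> = 3" and "t0 > 0"
  shows "monotone_operator Q \<and> lipschitz_operator Q \<and>
    (\<forall>\<theta>\<in>{1, \<alpha> - 1}.
      (\<exists>x c t1. solves_ode_on \<alpha> \<theta> Q t0 x \<and> c > 0 \<and> t1 > t0 \<and>
        (\<forall>t\<ge>t1. t * norm (Q (x t)) \<ge> c)) \<and>
      \<not> (\<forall>x. solves_ode_on \<alpha> \<theta> Q t0 x \<longrightarrow>
            (\<lambda>t. norm (Q (x t))) \<in> o[at_top](\<lambda>t. 1 / t)))"
proof (intro conjI ballI)
  show "monotone_operator Q" "lipschitz_operator Q"
    using assms(1) monotone_rotation90 lipschitz_rotation90 by simp_all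
next
  fix \<theta> assume "\<theta> \<in> {1, \<alpha> - 1}"
  then have "\<theta> = 1 \<or> \<theta> = 2" using assms(2) by auto
  then obtain x where x: "solves_ode_on \<alpha> \<theta> Q t0 x"
    and norm_x: "\<And>t. (norm (x t))\<^sup>2 = 1 / t^2 + 1 / t^4"
  proof
    assume "\<theta> = 1"
    with assms show thesis
      by (intro that[OF _ norm_solution_theta_1]) (simp only: solution_theta_1)
  next
    assume "\<theta> = 2"
    with assms show thesis
      by (intro that[OF _ norm_solution_theta_2]) (simp only: solution_theta_2)
  qed
  have lower: "t * norm (Q (x t)) \<ge> 1" if "t \<ge> t0 + 1" for t
    using mult_norm_ge_1[OF _ norm_x] that assms(1,3) by (simp add: norm_rotation90)
  show "\<exists>x c t1. solves_ode_on \<alpha> \<theta> Q t0 x \<and> c > 0 \<and> t1 > t0 \<and>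
      (\<forall>t\<ge>t1. t * norm (Q (x t)) \<ge> c)"
    using x lower by (intro exI[of _ x] exI[of _ "1::real"] exI[of _ "t0 + 1"]) simp
  show "\<not> (\<forall>x. solves_ode_on \<alpha> \<theta> Q t0 x \<longrightarrow>
      (\<lambda>t. norm (Q (x t))) \<in> o[at_top](\<lambda>t. 1 / t))"
    using x not_smallo_inverse_if_lower_bound[of 1 "t0 + 1" "\<lambda>t. norm (Q (x t))"] lower by auto
qed

end
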